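(* Let $(X,d)$ be a complete metric space, let $S\subset X$ be a nonempty closed set, let $Y$ be a real vector space quasi-ordered by a convex cone $D\subset Y$, and let $f:X\to Y$ be a map. Let $H\subset D$ be a $D$-convex set such that $0\notin\mathrm{vcl}(H+D)$. Let $\epsilon>0$ and let $x_0\in S$ be an $\epsilon$-efficient solution in the sense of Németh with respect to $H$ of the problem $\mathrm{Min}\{f(x):x\in S\}$, i.e. $(f(S)-f(x_0))\cap(-\epsilon H-D)=\emptyset$. Moreover, assume that $H+D$ is $h_0$-closed for a certain $h_0\in H$ and that $f$ is submonotone with respect to $D$. Then, for any $\gamma>0$, there exists $\hat{x}\in S$ such that (a) $f(x_0)\in f(\hat{x})+\gamma d(x_0,\hat{x})H+D$; (b) $d(x_0,\hat{x})<\epsilon/\gamma$; (c) for all $x\in S\setminus\{\hat{x}\}$, $f(\hat{x})\notin f(x)+\gamma d(\hat{x},x)H+D$.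
   Context: A convex cone is a nonempty set $D\subset Y$ with $D+D\subset D$ and $\alpha D\subset D$ for all $\alpha\ge0$; it defines the quasi-order $y_1\le_D y_2\iff y_1-y_2\in-D$. Sums and scalar multiples of sets are elementwise. A set $H\subset Y$ is $D$-convex if $H+D$ is convex. The vector closure of $A\subset Y$ is $$\mathrm{vcl}(A)=\{y\in Y:\ \exists v\in Y,\ \exists\lambda_n\ge0,\ \lambda_n\to0 \text{ such that } y+\lambda_n v\in A\ \forall n\in\mathbb{N}\}.$$ For $v_0\in Y$, the $v_0$-closure of $A$ is $$\mathrm{vcl}_{v_0}(A)=\{y\in Y:\ \exists\lambda_n\ge0,\ \lambda_n\to0 \text{ such that } y+\lambda_n v_0\in A\ \forall n\in\mathbb{N}\},$$ and $A$ is $v_0$-closed if $A=\mathrm{vcl}_{v_0}(A)$. The map $f:X\to Y$ is (sequentially) submonotone with respect to $D$ if for every $x\in X$ and every sequence $(x_n)$ in $X$ with $x_n\to x$ and $f(x_m)\le_D f(x_n)$ for all $m>n$, one has $f(x)\le_D f(x_n)$ for all $n$. *)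

theory Defs
  imports "HOL-Analysis.Analysis"
begin

text \<open>
  On sets, \<open>A + B\<close> is the elementwise sum (from \<^theory>\<open>HOL-Library.Set_Algebras\<close>), but \<open>- A\<close> and
  \<open>A - B\<close> are the complement and the set difference; elementwise negatives, differences and
  scalar multiples are therefore written as images throughout.
\<close>

lemma convex_cone_iff_set_plus:
  fixes D :: "'b::real_vector set"
  shows "convex_cone D \<longleftrightarrow> D \<noteq> {} \<and> D + D \<subseteq> D \<and> (\<forall>\<alpha>\<ge>0. (*\<^sub>R) \<alpha> ` D \<subseteq> D)"
proof
  assume "convex_cone D"
  then show "D \<noteq> {} \<and> D + D \<subseteq> D \<and> (\<forall>\<alpha>\<ge>0. (*\<^sub>R) \<alpha> ` D \<subseteq> D)"
    by (auto simp: set_plus_def convex_cone_nonempty convex_cone_add convex_cone_scaleR)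
next
  assume D: "D \<noteq> {} \<and> D + D \<subseteq> D \<and> (\<forall>\<alpha>\<ge>0. (*\<^sub>R) \<alpha> ` D \<subseteq> D)"
  have add: "x + y \<in> D" if "x \<in> D" "y \<in> D" for x y
    using D that by (meson set_plus_intro subsetD)
  have scale: "c *\<^sub>R x \<in> D" if "x \<in> D" "0 \<le> c" for x c
    using D that by blast
  show "convex_cone D"
    unfolding convex_cone_def conic_def convex_def using D add scale by blast
qed

definition cone_le :: "'b::real_vector set \<Rightarrow> 'b \<Rightarrow> 'b \<Rightarrow> bool" where
  "cone_le D y1 y2 \<longleftrightarrow> y1 - y2 \<in> uminus ` D"

definition cone_convex :: "'b::real_vector set \<Rightarrow> 'b set \<Rightarrow> bool" where
  "cone_convex D H \<longleftrightarrow> convex (H + D)"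

definition vcl :: "'b::real_vector set \<Rightarrow> 'b set" where
  "vcl A = {y. \<exists>v. \<exists>l :: nat \<Rightarrow> real. (\<forall>n. l n \<ge> 0) \<and> l \<longlonglongrightarrow> 0 \<and> (\<forall>n. y + l n *\<^sub>R v \<in> A)}"

definition vcl_dir :: "'b::real_vector \<Rightarrow> 'b set \<Rightarrow> 'b set" where
  "vcl_dir v0 A = {y. \<exists>l :: nat \<Rightarrow> real. (\<forall>n. l n \<ge> 0) \<and> l \<longlonglongrightarrow> 0 \<and> (\<forall>n. y + l n *\<^sub>R v0 \<in> A)}"

definition closed_dir :: "'b::real_vector \<Rightarrow> 'b set \<Rightarrow> bool" where
  "closed_dir v0 A \<longleftrightarrow> A = vcl_dir v0 A"

definition submonotone :: "'b::real_vector set \<Rightarrow> ('a::metric_space \<Rightarrow> 'b) \<Rightarrow> bool" where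
  "submonotone D f \<longleftrightarrow>
     (\<forall>x. \<forall>xs :: nat \<Rightarrow> 'a. xs \<longlonglongrightarrow> x \<and> (\<forall>m n. m > n \<longrightarrow> cone_le D (f (xs m)) (f (xs n))) \<longrightarrow>
        (\<forall>n. cone_le D (f x) (f (xs n))))"

text \<open>\<open>\<epsilon>\<close>-efficiency in the sense of Nemeth: \<open>(f(S) - f(x0)) \<inter> (-\<epsilon>H - D) = \<emptyset>\<close>.\<close>

definition nemeth_efficient ::
    "'b::real_vector set \<Rightarrow> 'b set \<Rightarrow> real \<Rightarrow> ('a \<Rightarrow> 'b) \<Rightarrow> 'a set \<Rightarrow> 'a \<Rightarrow> bool" where
  "nemeth_efficient D H \<epsilon> f S x0 \<longleftrightarrow>
     x0 \<in> S \<and> (\<lambda>x. f x - f x0) ` S \<inter> ((*\<^sub>R) (- \<epsilon>) ` H + uminus ` D) = {}"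

end

theory Submission
  imports Defs
begin

text \<open>
  Write \<open>K\<^sub>t = t H + D\<close> for \<open>t \<ge> 0\<close>. Because \<open>H + D\<close> is convex and \<open>H \<subseteq> D\<close>, these sets satisfy
  \<open>K\<^sub>s + K\<^sub>t \<subseteq> K\<^bsub>s+t\<^esub>\<close> and shrink as \<open>t\<close> grows. With the triangle inequality this makes
  \<open>y \<preceq> x \<longleftrightarrow> f x - f y \<in> K\<^bsub>\<gamma> d(x,y)\<^esub>\<close> a quasi-order, and the conclusions (a) and (c) say that
  \<open>xhat\<close> lies below \<open>x0\<close> and that no point of \<open>S\<close> other than \<open>xhat\<close> lies below \<open>xhat\<close>. Such a
  minimal point comes from the set-valued form of Ekeland's principle
  (\<open>exists_minimal_below\<close>), which asks for two properties of descending sequences.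

  \<^item> Their steps tend to \<open>0\<close>. Along a descending sequence below \<open>x0\<close> the memberships add up:
    \<open>f x0 - f (x\<^sub>n)\<close> lies in \<open>K\<^sub>t\<close>, where \<open>t\<close> is \<open>\<gamma>\<close> times the length of the path travelled.
    Efficiency of \<open>x0\<close> excludes \<open>K\<^sub>\<epsilon>\<close>, hence every \<open>K\<^sub>t\<close> with \<open>t \<ge> \<epsilon>\<close>, so the length stays below
    \<open>\<epsilon> / \<gamma>\<close>. The same exclusion gives the distance bound (b).

  \<^item> Their limits are lower bounds. Submonotonicity yields \<open>f x \<le>\<^sub>D f (x\<^sub>m)\<close> for the limit \<open>x\<close>,
    so \<open>f (x\<^sub>n) - f x\<close> lies in \<open>K\<^sub>t\<close> for each \<open>t = \<gamma> d(x\<^sub>n, x\<^sub>m)\<close> with \<open>m \<ge> n\<close>. The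
    \<open>h0\<close>-closedness of \<open>H + D\<close> allows passing to the limit in \<open>t\<close> (\<open>shifted_dilation_limit\<close>).
\<close>

section \<open>Minimal points of quasi-orders on complete metric spaces\<close>

text \<open>
  The principle of Dancs, Hegedus and Medvegyev. If no point below \<open>x\<close> had all its lower points
  within \<open>e\<close>, one could descend forever with steps of size at least \<open>e\<close>; so some descending
  sequence has lower sections of radius tending to \<open>0\<close>. It is Cauchy, and the lower section of its
  limit, being contained in all of these, is a single point.
\<close>

lemma exists_minimal_below:
  fixes le :: "'a::complete_space \<Rightarrow> 'a \<Rightarrow> bool"
  assumes refl: "\<And>x. le x x"
    and trans: "\<And>x y z. le z y \<Longrightarrow> le y x \<Longrightarrow> le z x"
    and S: "closed S" "x0 \<in> S"
    and lim: "\<And>xs x n. (\<And>n. le (xs (Suc n)) (xs n)) \<Longrightarrow> xs \<longlonglongrightarrow> x \<Longrightarrow> le x (xs n)"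
    and steps: "\<And>xs. (\<And>n. xs n \<in> S \<and> le (xs n) x0) \<Longrightarrow> (\<And>n. le (xs (Suc n)) (xs n))
        \<Longrightarrow> (\<lambda>n. dist (xs n) (xs (Suc n))) \<longlonglongrightarrow> 0"
  shows "\<exists>x\<in>S. le x x0 \<and> (\<forall>z\<in>S. le z x \<longrightarrow> z = x)"
proof -
  define P where "P x \<longleftrightarrow> x \<in> S \<and> le x x0" for x
  define small where "small e x \<longleftrightarrow> (\<forall>z\<in>S. le z x \<longrightarrow> dist x z < e)" for e :: real and x
  have ex_small: "\<exists>y. P y \<and> le y x \<and> small e y" if x: "P x" and e: "e > 0" for x e
  proof (rule ccontr)
    assume none: "\<not> ?thesis"
    have next_far: "\<exists>z. (P z \<and> le z x) \<and> (le z y \<and> dist y z \<ge> e)" if "P y \<and> le y x" for y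
    proof -
      from that none obtain z where "z \<in> S" "le z y" "\<not> dist y z < e"
        unfolding small_def by blast
      then show ?thesis using that trans unfolding P_def by (metis not_less)
    qed
    have start: "\<exists>z. P z \<and> le z x" using x refl by blast
    obtain xs where xs: "\<And>n. P (xs n) \<and> le (xs n) x"
        "\<And>n. le (xs (Suc n)) (xs n) \<and> dist (xs n) (xs (Suc n)) \<ge> e"
      using dependent_nat_choice[of "\<lambda>n z. P z \<and> le z x" "\<lambda>n y z. le z y \<and> dist y z \<ge> e"]
        start next_far by metis
    have "(\<lambda>n. dist (xs n) (xs (Suc n))) \<longlonglongrightarrow> 0"
      by (rule steps) (use xs P_def in auto)
    then have "e \<le> 0"
      by (rule LIMSEQ_le_const) (use xs in blast)
    with e show False by simp
  qed
  have P0: "P x0" using S refl unfolding P_def by blast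
  have start: "\<exists>y. P y \<and> small (inverse (real (Suc 0))) y"
    using ex_small[OF P0, of "inverse (real (Suc 0))"] by auto
  have next_small: "\<exists>z. (P z \<and> small (inverse (real (Suc (Suc n)))) z) \<and> le z y"
    if "P y \<and> small (inverse (real (Suc n))) y" for y n
  proof -
    have "inverse (real (Suc (Suc n))) > 0" by simp
    then show ?thesis using ex_small that by blast
  qed
  obtain ys where ys: "\<And>n. P (ys n) \<and> small (inverse (real (Suc n))) (ys n)"
      "\<And>n. le (ys (Suc n)) (ys n)"
    using dependent_nat_choice[of "\<lambda>n z. P z \<and> small (inverse (real (Suc n))) z" "\<lambda>n y z. le z y"]
      start next_small by metis
  have mono: "le (ys m) (ys n)" if "n \<le> m" for m n
    using that by (induction rule: dec_induct) (auto intro: refl trans ys(2))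
  have near: "dist (ys n) z < inverse (real (Suc n))" if "z \<in> S" "le z (ys n)" for z n
    using ys(1) that unfolding small_def by blast
  have "Cauchy ys"
    unfolding Cauchy_altdef
  proof (intro allI impI)
    fix e :: real assume "e > 0"
    then obtain N where N: "inverse (real (Suc N)) < e" using reals_Archimedean by blast
    have "dist (ys m) (ys n) < e" if "m \<ge> N" "n > m" for m n
    proof -
      have "dist (ys m) (ys n) < inverse (real (Suc m))"
        by (rule near) (use ys(1) P_def mono that in auto)
      also have "\<dots> \<le> inverse (real (Suc N))" using that by simp
      finally show ?thesis using N by simp
    qed
    then show "\<exists>M. \<forall>m\<ge>M. \<forall>n>m. dist (ys m) (ys n) < e" by blast
  qed
  then obtain x where x: "ys \<longlonglongrightarrow> x"
    using convergent_eq_Cauchy by metis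
  have xS: "x \<in> S" by (rule closed_sequentially[OF S(1) _ x]) (use ys(1) P_def in blast)
  have below: "le x (ys n)" for n using lim ys(2) x by blast
  have "z = x" if z: "z \<in> S" "le z x" for z
  proof -
    have "dist (ys n) z \<le> inverse (real (Suc n))" for n
      using near[OF z(1)] trans[OF z(2) below] less_imp_le by blast
    then have "\<forall>n. norm (dist (ys n) z) \<le> inverse (real (Suc n))" by simp
    then have "(\<lambda>n. dist (ys n) z) \<longlonglongrightarrow> 0"
      by (rule Lim_null_comparison[OF always_eventually LIMSEQ_inverse_real_of_nat])
    then have "ys \<longlonglongrightarrow> z" by (rule iffD2[OF tendsto_dist_iff])
    then show ?thesis using x LIMSEQ_unique by blast
  qed
  moreover have "le x x0" using below[of 0] ys(1)[of 0] trans unfolding P_def by blast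
  ultimately show ?thesis using xS by blast
qed

section \<open>The sets \<open>t H + D\<close>\<close>

definition shifted_dilation :: "'b::real_vector set \<Rightarrow> 'b set \<Rightarrow> real \<Rightarrow> 'b set" where
  "shifted_dilation D H t = (*\<^sub>R) t ` H + D"

lemma shifted_dilation_iff:
  "y \<in> shifted_dilation D H t \<longleftrightarrow> (\<exists>h\<in>H. \<exists>d\<in>D. y = t *\<^sub>R h + d)"
  unfolding shifted_dilation_def set_plus_def by blast

lemma shifted_dilation_subset_cone:
  assumes "convex_cone D" "H \<subseteq> D" "0 \<le> t"
  shows "shifted_dilation D H t \<subseteq> D"
  using assms by (auto simp: shifted_dilation_iff intro!: convex_cone_add convex_cone_scaleR)

lemma shifted_dilation_plus_cone:
  assumes "convex_cone D" "y \<in> shifted_dilation D H t" "z \<in> D"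
  shows "y + z \<in> shifted_dilation D H t"
proof -
  from assms obtain h d where "h \<in> H" "d \<in> D" "y = t *\<^sub>R h + d" by (auto simp: shifted_dilation_iff)
  moreover from this have "d + z \<in> D" using assms convex_cone_add by blast
  ultimately show ?thesis unfolding shifted_dilation_iff by (metis add.assoc)
qed

lemma shifted_dilation_0:
  assumes "h \<in> H" "y \<in> D"
  shows "y \<in> shifted_dilation D H 0"
  unfolding shifted_dilation_iff using assms by (intro bexI[of _ h] bexI[of _ y]) auto

text \<open>Since \<open>t h = s h + (t - s) h\<close>, the surplus can be absorbed into \<open>D\<close>.\<close>

lemma shifted_dilation_antimono:
  assumes "convex_cone D" "H \<subseteq> D" "s \<le> t"
  shows "shifted_dilation D H t \<subseteq> shifted_dilation D H s"
proof
  fix y assume "y \<in> shifted_dilation D H t"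
  then obtain h d where h: "h \<in> H" "d \<in> D" "y = t *\<^sub>R h + d" by (auto simp: shifted_dilation_iff)
  have "(t - s) *\<^sub>R h + d \<in> D"
    using assms h by (intro convex_cone_add convex_cone_scaleR) auto
  moreover have "y = s *\<^sub>R h + ((t - s) *\<^sub>R h + d)" using h by (simp add: algebra_simps)
  ultimately show "y \<in> shifted_dilation D H s" using h(1) unfolding shifted_dilation_iff by blast
qed

lemma mem_shifted_dilation_scale:
  assumes D: "convex_cone D" and t: "t > 0"
  shows "t *\<^sub>R y \<in> shifted_dilation D H t \<longleftrightarrow> y \<in> H + D"
proof
  assume "t *\<^sub>R y \<in> shifted_dilation D H t"
  then obtain h d where h: "h \<in> H" "d \<in> D" "t *\<^sub>R y = t *\<^sub>R h + d" by (auto simp: shifted_dilation_iff)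
  have "(1 / t) *\<^sub>R (t *\<^sub>R y) = (1 / t) *\<^sub>R (t *\<^sub>R h + d)" by (simp only: h(3))
  then have "y = h + (1 / t) *\<^sub>R d" using t by (simp add: scaleR_add_right)
  moreover have "(1 / t) *\<^sub>R d \<in> D" using D h t by (intro convex_cone_scaleR) auto
  ultimately show "y \<in> H + D" using set_plus_intro[OF h(1)] by simp
next
  assume "y \<in> H + D"
  then obtain h d where h: "h \<in> H" "d \<in> D" "y = h + d" by (auto elim: set_plus_elim)
  moreover have "t *\<^sub>R d \<in> D" using D h t by (intro convex_cone_scaleR) auto
  ultimately show "t *\<^sub>R y \<in> shifted_dilation D H t"
    unfolding shifted_dilation_iff using scaleR_add_right by blast
qed

text \<open>
  The weighted mean of two points of \<open>H\<close> need not lie in \<open>H\<close>, but it lies in the convex set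
  \<open>H + D\<close>; the error is again absorbed into \<open>D\<close>.
\<close>

lemma shifted_dilation_add:
  assumes D: "convex_cone D" and conv: "cone_convex D H"
    and s: "0 \<le> s" and t: "0 \<le> t"
    and a: "a \<in> shifted_dilation D H s" and b: "b \<in> shifted_dilation D H t"
  shows "a + b \<in> shifted_dilation D H (s + t)"
proof -
  obtain h d where h: "h \<in> H" "d \<in> D" "a = s *\<^sub>R h + d" using a by (auto simp: shifted_dilation_iff)
  obtain k e where k: "k \<in> H" "e \<in> D" "b = t *\<^sub>R k + e" using b by (auto simp: shifted_dilation_iff)
  have de: "d + e \<in> D" using D h k convex_cone_add by blast
  show ?thesis
  proof (cases "s + t = 0")
    case True
    then have "s = 0" "t = 0" using s t by auto
    then have "a + b = d + e" using h k by simp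
    then show ?thesis using True shifted_dilation_0[OF h(1) de] by simp
  next
    case False
    then have st: "s + t > 0" using s t by simp
    have 0: "0 \<in> D" using D convex_cone_contains_0 by blast
    have "h \<in> H + D" "k \<in> H + D"
      using set_plus_intro[OF h(1) 0] set_plus_intro[OF k(1) 0] by simp_all
    then have "(s / (s + t)) *\<^sub>R h + (t / (s + t)) *\<^sub>R k \<in> H + D"
      using conv s t st unfolding cone_convex_def
      by (intro convexD) (auto simp: add_divide_distrib[symmetric])
    then have "(s + t) *\<^sub>R ((s / (s + t)) *\<^sub>R h + (t / (s + t)) *\<^sub>R k) \<in> shifted_dilation D H (s + t)"
      using mem_shifted_dilation_scale[OF D st] by blast
    also have "(s + t) *\<^sub>R ((s / (s + t)) *\<^sub>R h + (t / (s + t)) *\<^sub>R k) = s *\<^sub>R h + t *\<^sub>R k"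
      using st by (simp add: scaleR_add_right)
    finally have "s *\<^sub>R h + t *\<^sub>R k + (d + e) \<in> shifted_dilation D H (s + t)"
      using shifted_dilation_plus_cone[OF D _ de] by blast
    then show ?thesis using h k by (simp add: algebra_simps)
  qed
qed

text \<open>
  Only factors \<open>c n < t\<close> are a problem. For these \<open>z + (t - c n) h0\<close> lies in \<open>t H + D\<close>, so
  after division by \<open>t\<close> the point \<open>z / t\<close> is approached along the direction \<open>h0\<close> from \<open>H + D\<close>.
\<close>

lemma shifted_dilation_limit:
  assumes D: "convex_cone D" and HD: "H \<subseteq> D" and conv: "cone_convex D H"
    and h0: "h0 \<in> H" and closed: "closed_dir h0 (H + D)"
    and c: "\<And>n. 0 \<le> c n" "c \<longlonglongrightarrow> t" and z: "\<And>n. z \<in> shifted_dilation D H (c n)"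
  shows "z \<in> shifted_dilation D H t"
proof -
  have "t \<ge> 0" using c by (intro LIMSEQ_le_const[of c]) auto
  then consider "t = 0" | "t > 0" by linarith
  then show ?thesis
  proof cases
    case 1
    then show ?thesis
      using shifted_dilation_0[OF h0] shifted_dilation_subset_cone[OF D HD c(1)] z by blast
  next
    case 2
    define l where "l n = max 0 (1 - c n / t)" for n
    have "(\<lambda>n. max 0 (1 - c n / t)) \<longlonglongrightarrow> max 0 (1 - t / t)"
      using 2 c(2) by (intro tendsto_intros) auto
    then have l: "l \<longlonglongrightarrow> 0" unfolding l_def using 2 by simp
    have "(1 / t) *\<^sub>R z + l n *\<^sub>R h0 \<in> H + D" for n
    proof -
      have "z + (t * l n) *\<^sub>R h0 \<in> shifted_dilation D H t"
      proof (cases "c n \<ge> t")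
        case True
        then have "l n = 0" using 2 by (simp add: l_def)
        then show ?thesis using True shifted_dilation_antimono[OF D HD True] z[of n] by auto
      next
        case False
        then have tl: "t * l n = t - c n" using 2 by (simp add: l_def max_def field_simps)
        have "(t - c n) *\<^sub>R h0 \<in> shifted_dilation D H (t - c n)"
          unfolding shifted_dilation_iff using h0 convex_cone_contains_0[OF D]
          by (intro bexI[of _ h0] bexI[of _ 0]) auto
        then have "z + (t - c n) *\<^sub>R h0 \<in> shifted_dilation D H (c n + (t - c n))"
          using False c(1) by (intro shifted_dilation_add[OF D conv _ _ z]) auto
        then show ?thesis using tl by simp
      qed
      moreover have "z + (t * l n) *\<^sub>R h0 = t *\<^sub>R ((1 / t) *\<^sub>R z + l n *\<^sub>R h0)"
        using 2 by (simp add: scaleR_add_right)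
      ultimately show ?thesis using mem_shifted_dilation_scale[OF D 2] by metis
    qed
    then have "(1 / t) *\<^sub>R z \<in> vcl_dir h0 (H + D)"
      unfolding vcl_dir_def using l by (auto intro!: exI[of _ l] simp: l_def)
    then have "(1 / t) *\<^sub>R z \<in> H + D" using closed unfolding closed_dir_def by blast
    then have "t *\<^sub>R ((1 / t) *\<^sub>R z) \<in> shifted_dilation D H t"
      using mem_shifted_dilation_scale[OF D 2] by blast
    then show ?thesis using 2 by simp
  qed
qed

section \<open>Ekeland's principle for approximate efficient solutions\<close>

lemma cone_le_iff: "cone_le D y1 y2 \<longleftrightarrow> y2 - y1 \<in> D"
proof -
  have "y1 - y2 = - (y2 - y1)" by simp
  then show ?thesis unfolding cone_le_def by (metis image_iff neg_equal_iff_equal)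
qed

lemma mem_singleton_plus_dilation_iff:
  "y \<in> {z} + (*\<^sub>R) t ` H + D \<longleftrightarrow> y - z \<in> shifted_dilation D H t"
proof -
  have "y \<in> {z} + (*\<^sub>R) t ` H + D \<longleftrightarrow> y \<in> {z} + shifted_dilation D H t"
    unfolding shifted_dilation_def by (simp add: add.assoc)
  also have "\<dots> \<longleftrightarrow> y - z \<in> shifted_dilation D H t"
    unfolding set_plus_def by (auto intro: bexI[of _ "y - z"])
  finally show ?thesis .
qed

lemma nemeth_efficient_not_mem:
  assumes "nemeth_efficient D H \<epsilon> f S x0" "x \<in> S"
  shows "f x0 - f x \<notin> shifted_dilation D H \<epsilon>"
proof
  assume "f x0 - f x \<in> shifted_dilation D H \<epsilon>"
  then obtain h d where hd: "h \<in> H" "d \<in> D" "f x0 - f x = \<epsilon> *\<^sub>R h + d"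
    by (auto simp: shifted_dilation_iff)
  have "f x - f x0 = - (f x0 - f x)" by simp
  also have "\<dots> = (- \<epsilon>) *\<^sub>R h + - d" using hd(3) by simp
  finally have "f x - f x0 \<in> (*\<^sub>R) (- \<epsilon>) ` H + uminus ` D"
    using set_plus_intro[OF imageI[OF hd(1)] imageI[OF hd(2)]] by metis
  with assms show False unfolding nemeth_efficient_def by blast
qed

theorem theorem4p2:
  fixes S :: "'a::complete_space set"
    and D H :: "'b::real_vector set"
    and f :: "'a \<Rightarrow> 'b"
    and x0 :: 'a and h0 :: 'b
    and \<epsilon> \<gamma> :: real
  assumes "S \<noteq> {}" and "closed S"
    and "convex_cone D"
    and "H \<subseteq> D" and "cone_convex D H"
    and "0 \<notin> vcl (H + D)"
    and "\<epsilon> > 0" and "nemeth_efficient D H \<epsilon> f S x0"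
    and "h0 \<in> H" and "closed_dir h0 (H + D)"
    and "submonotone D f"
    and "\<gamma> > 0"
  shows "\<exists>xhat\<in>S.
      f x0 \<in> {f xhat} + (*\<^sub>R) (\<gamma> * dist x0 xhat) ` H + D \<and>
      dist x0 xhat < \<epsilon> / \<gamma> \<and>
      (\<forall>x\<in>S - {xhat}. f xhat \<notin> {f x} + (*\<^sub>R) (\<gamma> * dist xhat x) ` H + D)"
proof -
  note D = assms(3) and HD = assms(4) and conv = assms(5) and eff = assms(8)
  define K where "K = shifted_dilation D H"
  define le where "le y x \<longleftrightarrow> f x - f y \<in> K (\<gamma> * dist x y)" for y x
  have x0: "x0 \<in> S" using eff unfolding nemeth_efficient_def by blast
  have g: "0 \<le> \<gamma> * dist x y" for x y :: 'a using assms(12) by simp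
  have K_add: "a + b \<in> K (s + t)" if "0 \<le> s" "0 \<le> t" "a \<in> K s" "b \<in> K t" for a b s t
    using shifted_dilation_add[OF D conv] that unfolding K_def by blast
  have K_anti: "a \<in> K s" if "a \<in> K t" "s \<le> t" for a s t
    using shifted_dilation_antimono[OF D HD] that unfolding K_def by blast
  have K_D: "a \<in> D" if "a \<in> K t" "0 \<le> t" for a t
    using shifted_dilation_subset_cone[OF D HD] that unfolding K_def by blast
  have K_plus_D: "a + b \<in> K t" if "a \<in> K t" "b \<in> D" for a b t
    using shifted_dilation_plus_cone[OF D] that unfolding K_def by blast
  have eff_bound: "t < \<epsilon>" if "x \<in> S" "f x0 - f x \<in> K t" for x t
    using nemeth_efficient_not_mem[OF eff that(1)] K_anti[OF that(2)] unfolding K_def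
    by (meson not_less)
  have refl: "le x x" for x
    using shifted_dilation_0[OF assms(9) convex_cone_contains_0[OF D]] unfolding le_def K_def by simp
  have trans: "le z x" if "le z y" "le y x" for x y z
  proof -
    have "(f x - f y) + (f y - f z) \<in> K (\<gamma> * dist x y + \<gamma> * dist y z)"
      using that unfolding le_def by (intro K_add g)
    moreover have "\<gamma> * dist x z \<le> \<gamma> * dist x y + \<gamma> * dist y z"
      using assms(12) dist_triangle[of x z y] by (simp add: distrib_left[symmetric])
    ultimately show ?thesis unfolding le_def using K_anti by simp
  qed
  have lim: "le x (xs n)" if dec: "\<And>n. le (xs (Suc n)) (xs n)" and x: "xs \<longlonglongrightarrow> x" for xs x n
  proof -
    have mono: "le (xs m) (xs n)" if "n \<le> m" for m n
      using that by (induction rule: dec_induct) (auto intro: refl trans dec)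
    have "cone_le D (f (xs m)) (f (xs n))" if "m > n" for m n
      using mono[of n m] that K_D g unfolding cone_le_iff le_def by fastforce
    then have below: "f (xs n) - f x \<in> D" for n
      using assms(11) x unfolding submonotone_def cone_le_iff by blast
    have "f (xs n) - f x \<in> K (\<gamma> * dist (xs n) (xs (m + n)))" for m
    proof -
      have "(f (xs n) - f (xs (m + n))) + (f (xs (m + n)) - f x) \<in> K (\<gamma> * dist (xs n) (xs (m + n)))"
        using mono[of n "m + n"] below by (intro K_plus_D) (auto simp: le_def)
      then show ?thesis by simp
    qed
    moreover have "(\<lambda>m. \<gamma> * dist (xs n) (xs (m + n))) \<longlonglongrightarrow> \<gamma> * dist (xs n) x"
      using LIMSEQ_ignore_initial_segment[OF x, of n] by (intro tendsto_intros)
    ultimately show ?thesis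
      unfolding le_def K_def
      using shifted_dilation_limit[OF D HD conv assms(9,10),
          of "\<lambda>m. \<gamma> * dist (xs n) (xs (m + n))" "\<gamma> * dist (xs n) x" "f (xs n) - f x"] g by blast
  qed
  have steps: "(\<lambda>n. dist (xs n) (xs (Suc n))) \<longlonglongrightarrow> 0"
    if xs: "\<And>n. xs n \<in> S \<and> le (xs n) x0" and dec: "\<And>n. le (xs (Suc n)) (xs n)" for xs
  proof -
    have path: "f x0 - f (xs n) \<in> K (\<Sum>i<n. \<gamma> * dist (xs i) (xs (Suc i)))" for n
    proof (induction n)
      case 0
      show ?case using xs[of 0] K_anti g unfolding le_def by simp blast
    next
      case (Suc n)
      have "(f x0 - f (xs n)) + (f (xs n) - f (xs (Suc n)))
          \<in> K ((\<Sum>i<n. \<gamma> * dist (xs i) (xs (Suc i))) + \<gamma> * dist (xs n) (xs (Suc n)))"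
        using Suc dec[of n] unfolding le_def by (intro K_add g sum_nonneg)
      then show ?case by simp
    qed
    have "(\<Sum>i<n. \<gamma> * dist (xs i) (xs (Suc i))) \<le> \<epsilon>" for n
      using eff_bound path xs less_imp_le by blast
    then have "summable (\<lambda>n. \<gamma> * dist (xs n) (xs (Suc n)))" by (rule summableI_nonneg_bounded[OF g])
    then have "summable (\<lambda>n. dist (xs n) (xs (Suc n)))" using assms(12) by (simp add: summable_cmult_iff)
    then show ?thesis by (rule summable_LIMSEQ_zero)
  qed
  have "\<exists>x\<in>S. le x x0 \<and> (\<forall>z\<in>S. le z x \<longrightarrow> z = x)"
    by (rule exists_minimal_below) (fact refl trans assms(2) x0 lim steps)+
  then obtain xhat where xhat: "xhat \<in> S" "le xhat x0" "\<forall>z\<in>S. le z xhat \<longrightarrow> z = xhat"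
    by blast
  have "\<gamma> * dist x0 xhat < \<epsilon>" using eff_bound xhat unfolding le_def by blast
  then have "dist x0 xhat < \<epsilon> / \<gamma>" using assms(12) by (simp add: field_simps)
  then show ?thesis
    unfolding mem_singleton_plus_dilation_iff using xhat unfolding le_def K_def by blast
qed

end
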